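(* For $\varphi\in L^\infty(\mathbb{T})$, the weighted dual truncated Toeplitz operator $D_\varphi^{\mathcal{M}}$ satisfies $$D_\varphi^{\mathcal{M}}(D_\varphi^{\mathcal{M}})^*=D_{|\varphi|^2}^{\mathcal{M}}-H_\varphi^{\mathcal{M}}(H_\varphi^{\mathcal{M}})^*$$ and $$(D_\varphi^{\mathcal{M}})^*D_\varphi^{\mathcal{M}}=D_{|\varphi|^2}^{\mathcal{M}}-H_{\bar\varphi}^{\mathcal{M}}(H_{\bar\varphi}^{\mathcal{M}})^*.$$
   Context: $\mathbb{D}$ is the open unit disk, $\mathbb{T}=\partial\mathbb{D}$, and $L^2(\mathbb{T})$ is taken with respect to normalized Lebesgue measure $m$, with inner product linear in the first variable. $H^2\subset L^2(\mathbb{T})$ is the Hardy space (functions with vanishing negative Fourier coefficients, also viewed as analytic functions on $\mathbb{D}$). For $f\in H^2$, $S^*f=(f-f(0))/z$. For an inner function $u$, $\mathcal{K}_u=H^2\ominus uH^2$. A closed subspace $\mathcal{M}\subset H^2$ is nearly $S^*$-invariant if $f\in\mathcal{M}$, $f(0)=0$ imply $S^*f\in\mathcal{M}$. Setting: $\mathcal{M}=h\mathcal{K}_u$ is a nonzero proper closed nearly $S^*$-invariant subspace of $H^2$, where $u$ is a nonconstant inner function with $u(0)=0$ and $h\in\mathcal{M}$ is the extremal function of $\mathcal{M}$: $\|h\|_2=1$, $h(0)>0$, $h\perp\{f\in\mathcal{M}:f(0)=0\}$, and multiplication by $h$ is an isometry from $\mathcal{K}_u$ onto $\mathcal{M}$.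 $\mathcal{M}^\perp=L^2(\mathbb{T})\ominus\mathcal{M}$, and $P_{\mathcal{M}^\perp}$ is the orthogonal projection of $L^2(\mathbb{T})$ onto it. $M_\varphi f=\varphi f$ on $L^2(\mathbb{T})$, and $D_\varphi^{\mathcal{M}}=P_{\mathcal{M}^\perp}M_\varphi|_{\mathcal{M}^\perp}:\mathcal{M}^\perp\to\mathcal{M}^\perp$. $V:\mathcal{K}_u\to L^2(\mathbb{T})$, $Vk=hk$, is an isometry with range $\mathcal{M}$. The weighted truncated Hankel operator with symbol $\varphi\in L^\infty(\mathbb{T})$ is $H_\varphi^{\mathcal{M}}=P_{\mathcal{M}^\perp}M_\varphi V:\mathcal{K}_u\to\mathcal{M}^\perp$. *)

theory Defs
  imports "HOL-Analysis.Analysis"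
begin

text \<open>
  Normalized Lebesgue measure on the unit circle, carried by the Borel sets of the whole
  plane: it is the image of the uniform measure on \<open>[0, 2\<pi>]\<close> under \<open>t \<mapsto> e\<^sup>i\<^sup>t\<close>, so that
  the complement of the circle is a null set and the values of a function off the circle
  are irrelevant.
\<close>

definition circle_measure :: "complex measure" where
  "circle_measure = distr (uniform_measure lborel {0..2 * pi}) borel cis"

definition square_integrable :: "(complex \<Rightarrow> complex) \<Rightarrow> bool" where
  "square_integrable f \<longleftrightarrow>
     f \<in> borel_measurable circle_measure \<and> integrable circle_measure (\<lambda>z. (cmod (f z))\<^sup>2)"

lemma sets_circle_measure [measurable_cong, simp]: "sets circle_measure = sets borel"
  by (simp add: circle_measure_def)

lemma borel_measurable_cnj [measurable]: "cnj \<in> borel_measurable borel"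
  by (intro borel_measurable_continuous_onI continuous_intros)

lemma square_integrable_zero: "square_integrable (\<lambda>_. 0)"
  by (simp add: square_integrable_def)

lemma finite_measure_circle_measure: "finite_measure circle_measure"
proof
  have "emeasure (uniform_measure lborel {0..2 * pi}) UNIV = 1"
    by (subst emeasure_uniform_measure) (auto simp: ennreal_divide_self)
  moreover have "cis \<in> borel_measurable (uniform_measure lborel {0..2 * pi})"
    by (simp add: borel_measurable_continuous_onI continuous_intros
        cong: measurable_cong_sets)
  ultimately show "emeasure circle_measure (space circle_measure) \<noteq> \<infinity>"
    by (simp add: circle_measure_def emeasure_distr)
qed

lemma square_integrable_const: "square_integrable (\<lambda>_. c)"
  using finite_measure.integrable_const[OF finite_measure_circle_measure]
  by (auto simp: square_integrable_def)

lemma square_integrable_add: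
  assumes "square_integrable f" "square_integrable g"
  shows "square_integrable (\<lambda>z. f z + g z)"
proof -
  have [measurable]: "f \<in> borel_measurable circle_measure" "g \<in> borel_measurable circle_measure"
    using assms by (auto simp: square_integrable_def)
  have *: "(cmod (a + b))\<^sup>2 \<le> 2 * (cmod a)\<^sup>2 + 2 * (cmod b)\<^sup>2" for a b
  proof -
    have "(cmod (a + b))\<^sup>2 \<le> (cmod a + cmod b)\<^sup>2"
      by (intro power_mono norm_triangle_ineq) auto
    also have "\<dots> \<le> 2 * (cmod a)\<^sup>2 + 2 * (cmod b)\<^sup>2"
      using sum_squares_bound[of "cmod a" "cmod b"] by (simp add: power2_sum)
    finally show ?thesis .
  qed
  have "integrable circle_measure (\<lambda>z. 2 * (cmod (f z))\<^sup>2 + 2 * (cmod (g z))\<^sup>2)"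
    using assms by (auto simp: square_integrable_def)
  then have "integrable circle_measure (\<lambda>z. (cmod (f z + g z))\<^sup>2)"
    by (rule Bochner_Integration.integrable_bound) (use * in auto)
  then show ?thesis by (simp add: square_integrable_def)
qed

lemma square_integrable_cmult:
  assumes "square_integrable f"
  shows "square_integrable (\<lambda>z. c * f z)"
  using assms by (auto simp: square_integrable_def norm_mult power_mult_distrib)

lemma square_integrable_uminus:
  assumes "square_integrable f"
  shows "square_integrable (\<lambda>z. - f z)"
  using assms by (auto simp: square_integrable_def)

lemma square_integrable_diff:
  assumes "square_integrable f" "square_integrable g"
  shows "square_integrable (\<lambda>z. f z - g z)"
  using square_integrable_add[OF assms(1) square_integrable_uminus[OF assms(2)]] by simp

lemma square_integrable_mult_cnj_integrable:
  assumes "square_integrable f" "square_integrable g"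
  shows "integrable circle_measure (\<lambda>z. f z * cnj (g z))"
proof -
  have [measurable]: "f \<in> borel_measurable circle_measure" "g \<in> borel_measurable circle_measure"
    using assms by (auto simp: square_integrable_def)
  have *: "cmod a * cmod b \<le> (cmod a)\<^sup>2 + (cmod b)\<^sup>2" for a b
    using sum_squares_bound[of "cmod a" "cmod b"]
      mult_nonneg_nonneg[OF norm_ge_zero[of a] norm_ge_zero[of b]] by linarith
  have "integrable circle_measure (\<lambda>z. (cmod (f z))\<^sup>2 + (cmod (g z))\<^sup>2)"
    using assms by (auto simp: square_integrable_def)
  then show ?thesis
    by (rule Bochner_Integration.integrable_bound) (use * in \<open>auto simp: norm_mult\<close>)
qed

definition L2_rel :: "(complex \<Rightarrow> complex) \<Rightarrow> (complex \<Rightarrow> complex) \<Rightarrow> bool" where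
  "L2_rel f g \<longleftrightarrow> square_integrable f \<and> square_integrable g \<and> (AE z in circle_measure. f z = g z)"

quotient_type circle_L2 = "complex \<Rightarrow> complex" / partial: L2_rel
proof (rule part_equivpI)
  show "\<exists>f. L2_rel f f"
    using square_integrable_zero by (auto simp: L2_rel_def)
  show "symp L2_rel"
    by (auto simp: L2_rel_def intro!: sympI)
  show "transp L2_rel"
  proof (rule transpI)
    fix f g h assume "L2_rel f g" "L2_rel g h"
    moreover from this have "AE z in circle_measure. f z = g z" "AE z in circle_measure. g z = h z"
      by (auto simp: L2_rel_def)
    then have "AE z in circle_measure. f z = h z" by eventually_elim auto
    ultimately show "L2_rel f h" by (auto simp: L2_rel_def)
  qed
qed

lift_definition cinner :: "circle_L2 \<Rightarrow> circle_L2 \<Rightarrow> complex" is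
  "\<lambda>f g. LINT z|circle_measure. f z * cnj (g z)"
proof -
  fix f f' g g' assume "L2_rel f f'" "L2_rel g g'"
  moreover from this have "AE z in circle_measure. f z = f' z" "AE z in circle_measure. g z = g' z"
    by (auto simp: L2_rel_def)
  then have "AE z in circle_measure. f z * cnj (g z) = f' z * cnj (g' z)" by eventually_elim auto
  ultimately show "(LINT z|circle_measure. f z * cnj (g z)) = (LINT z|circle_measure. f' z * cnj (g' z))"
    by (intro integral_cong_AE) (auto simp: L2_rel_def square_integrable_def)
qed

lift_definition cscale :: "complex \<Rightarrow> circle_L2 \<Rightarrow> circle_L2" is "\<lambda>c f z. c * f z"
  by (auto simp: L2_rel_def square_integrable_cmult)

lift_definition const_L2 :: "complex \<Rightarrow> circle_L2" is "\<lambda>c z. c"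
  by (auto simp: L2_rel_def square_integrable_const)

instantiation circle_L2 :: real_inner
begin

lift_definition zero_circle_L2 :: circle_L2 is "\<lambda>_. 0"
  by (simp add: L2_rel_def square_integrable_zero)

lift_definition plus_circle_L2 :: "circle_L2 \<Rightarrow> circle_L2 \<Rightarrow> circle_L2" is "\<lambda>f g z. f z + g z"
  by (auto simp: L2_rel_def square_integrable_add elim: eventually_elim2)

lift_definition minus_circle_L2 :: "circle_L2 \<Rightarrow> circle_L2 \<Rightarrow> circle_L2" is "\<lambda>f g z. f z - g z"
  by (auto simp: L2_rel_def square_integrable_diff elim: eventually_elim2)

lift_definition uminus_circle_L2 :: "circle_L2 \<Rightarrow> circle_L2" is "\<lambda>f z. - f z"
  by (auto simp: L2_rel_def square_integrable_uminus)

definition scaleR_circle_L2 :: "real \<Rightarrow> circle_L2 \<Rightarrow> circle_L2" where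
  "scaleR_circle_L2 r = cscale (complex_of_real r)"

definition inner_circle_L2 :: "circle_L2 \<Rightarrow> circle_L2 \<Rightarrow> real" where
  "inner_circle_L2 f g = Re (cinner f g)"

definition norm_circle_L2 :: "circle_L2 \<Rightarrow> real" where
  "norm_circle_L2 f = sqrt (Re (cinner f f))"

definition sgn_circle_L2 :: "circle_L2 \<Rightarrow> circle_L2" where
  "sgn_circle_L2 f = scaleR (inverse (norm f)) f"

definition dist_circle_L2 :: "circle_L2 \<Rightarrow> circle_L2 \<Rightarrow> real" where
  "dist_circle_L2 f g = norm (f - g)"

definition uniformity_circle_L2 :: "(circle_L2 \<times> circle_L2) filter" where
  "uniformity_circle_L2 = (INF e\<in>{0<..}. principal {(x, y). dist x y < e})"

definition open_circle_L2 :: "circle_L2 set \<Rightarrow> bool" where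
  "open_circle_L2 U \<longleftrightarrow> (\<forall>x\<in>U. \<forall>\<^sub>F (x', y) in uniformity. x' = x \<longrightarrow> y \<in> U)"

instance
proof
  fix a b c :: circle_L2 and r s :: real
  show "a + b + c = a + (b + c)"
    by transfer (auto simp: L2_rel_def algebra_simps intro!: square_integrable_add)
  show "a + b = b + a"
    by transfer (auto simp: L2_rel_def algebra_simps intro!: square_integrable_add)
  show "0 + a = a"
    by transfer (auto simp: L2_rel_def)
  show "- a + a = 0"
    by transfer (auto simp: L2_rel_def square_integrable_zero)
  show "a - b = a + - b"
    by transfer (auto simp: L2_rel_def intro!: square_integrable_diff)
  show "r *\<^sub>R (a + b) = r *\<^sub>R a + r *\<^sub>R b"
    unfolding scaleR_circle_L2_def
    by transfer (auto simp: L2_rel_def distrib_left intro!: square_integrable_add square_integrable_cmult)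
  show "(r + s) *\<^sub>R a = r *\<^sub>R a + s *\<^sub>R a"
    unfolding scaleR_circle_L2_def
    by transfer (auto simp: L2_rel_def distrib_right intro!: square_integrable_add square_integrable_cmult)
  show "r *\<^sub>R s *\<^sub>R a = (r * s) *\<^sub>R a"
    unfolding scaleR_circle_L2_def
    by transfer (auto simp: L2_rel_def mult.assoc intro!: square_integrable_cmult)
  show "1 *\<^sub>R a = a"
    unfolding scaleR_circle_L2_def by transfer (auto simp: L2_rel_def)
  show "dist a b = norm (a - b)" by (rule dist_circle_L2_def)
  show "sgn a = scaleR (inverse (norm a)) a" by (rule sgn_circle_L2_def)
  show "(uniformity :: (circle_L2 \<times> circle_L2) filter) = (INF e\<in>{0<..}. principal {(x, y). dist x y < e})"
    by (rule uniformity_circle_L2_def)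
  show "open U \<longleftrightarrow> (\<forall>x\<in>U. \<forall>\<^sub>F (x', y) in uniformity. x' = x \<longrightarrow> y \<in> U)" for U :: "circle_L2 set"
    by (rule open_circle_L2_def)
  have cnj: "cinner b a = cnj (cinner a b)"
  proof transfer
    fix a b
    show "(LINT z|circle_measure. b z * cnj (a z)) = cnj (LINT z|circle_measure. a z * cnj (b z))"
      using Bochner_Integration.integral_cnj[of circle_measure "\<lambda>z. a z * cnj (b z)"] by (simp add: mult.commute)
  qed
  then show "inner a b = inner b a"
    by (simp add: inner_circle_L2_def)
  have "cinner (a + b) c = cinner a c + cinner b c"
  proof transfer
    fix a b c assume "L2_rel a a" "L2_rel b b" "L2_rel c c"
    then show "(LINT z|circle_measure. (a z + b z) * cnj (c z)) =
      (LINT z|circle_measure. a z * cnj (c z)) + (LINT z|circle_measure. b z * cnj (c z))"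
      by (subst Bochner_Integration.integral_add [symmetric])
        (auto simp: L2_rel_def algebra_simps intro!: square_integrable_mult_cnj_integrable)
  qed
  then show "inner (a + b) c = inner a c + inner b c"
    by (simp add: inner_circle_L2_def)
  have "cinner (cscale t a) b = t * cinner a b" for t
    by transfer (simp add: mult.assoc)
  then show "inner (r *\<^sub>R a) b = r * inner a b"
    by (simp add: inner_circle_L2_def scaleR_circle_L2_def)
  have self: "Re (cinner a a) \<ge> 0 \<and> (Re (cinner a a) = 0 \<longleftrightarrow> a = 0)"
  proof transfer
    fix a assume a: "L2_rel a a"
    then have int: "integrable circle_measure (\<lambda>z. (cmod (a z))\<^sup>2)"
      by (auto simp: L2_rel_def square_integrable_def)
    have eq: "(LINT z|circle_measure. a z * cnj (a z)) =
        complex_of_real (LINT z|circle_measure. (cmod (a z))\<^sup>2)"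
      by (simp only: complex_norm_square[symmetric] integral_complex_of_real)
    have "(LINT z|circle_measure. (cmod (a z))\<^sup>2) = 0 \<longleftrightarrow> (AE z in circle_measure. a z = 0)"
      using integral_nonneg_eq_0_iff_AE[OF int] by simp
    then show "0 \<le> Re (LINT z|circle_measure. a z * cnj (a z)) \<and>
        (Re (LINT z|circle_measure. a z * cnj (a z)) = 0) = L2_rel a (\<lambda>_. 0)"
      using a unfolding eq by (auto simp: L2_rel_def square_integrable_zero)
  qed
  show "inner a a \<ge> 0" "inner a a = 0 \<longleftrightarrow> a = 0"
    using self by (simp_all add: inner_circle_L2_def)
  show "norm a = sqrt (inner a a)"
    by (simp add: norm_circle_L2_def inner_circle_L2_def)
qed

end

definition csubspace :: "circle_L2 set \<Rightarrow> bool" where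
  "csubspace A \<longleftrightarrow> 0 \<in> A \<and> (\<forall>f\<in>A. \<forall>g\<in>A. f + g \<in> A) \<and> (\<forall>c. \<forall>f\<in>A. cscale c f \<in> A)"

definition ortho :: "circle_L2 set \<Rightarrow> circle_L2 set" where
  "ortho A = {f. \<forall>g\<in>A. cinner f g = 0}"

definition proj :: "circle_L2 set \<Rightarrow> circle_L2 \<Rightarrow> circle_L2" where
  "proj A f = (THE g. g \<in> A \<and> f - g \<in> ortho A)"

text \<open>
  Adjoint of an operator \<open>T\<close> defined on the subspace \<open>A\<close>: the vector \<open>T\<^sup>*y\<close> is the element of
  \<open>A\<close> with \<open>\<langle>Ta, y\<rangle> = \<langle>a, T\<^sup>*y\<rangle>\<close> for all \<open>a \<in> A\<close>. If \<open>T\<close> maps \<open>A\<close> into a subspace \<open>B\<close>, the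
  adjoint of \<open>T : A \<rightarrow> B\<close> is the restriction of this map to \<open>B\<close>.
\<close>

definition adjoint_on :: "circle_L2 set \<Rightarrow> (circle_L2 \<Rightarrow> circle_L2) \<Rightarrow> circle_L2 \<Rightarrow> circle_L2" where
  "adjoint_on A T y = (THE x. x \<in> A \<and> (\<forall>a\<in>A. cinner (T a) y = cinner a x))"

text \<open>
  Multiplication by a function \<open>\<phi>\<close>, with the junk value \<open>0\<close> when \<open>\<phi>\<close> is not measurable or
  the product is not in \<open>L\<^sup>2\<close>.
\<close>

lift_definition mult_op :: "(complex \<Rightarrow> complex) \<Rightarrow> circle_L2 \<Rightarrow> circle_L2" is
  "\<lambda>\<phi> f. if \<phi> \<in> borel_measurable circle_measure \<and> square_integrable (\<lambda>z. \<phi> z * f z)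
         then (\<lambda>z. \<phi> z * f z) else (\<lambda>_. 0)"
proof -
  fix \<phi> f g assume fg: "L2_rel f g"
  have AE: "AE z in circle_measure. \<phi> z * f z = \<phi> z * g z"
    using fg by (auto simp: L2_rel_def)
  have "square_integrable (\<lambda>z. \<phi> z * f z) \<longleftrightarrow> square_integrable (\<lambda>z. \<phi> z * g z)"
    if [measurable]: "\<phi> \<in> borel_measurable circle_measure"
  proof -
    have [measurable]: "f \<in> borel_measurable circle_measure" "g \<in> borel_measurable circle_measure"
      using fg by (auto simp: L2_rel_def square_integrable_def)
    have "integrable circle_measure (\<lambda>z. (cmod (\<phi> z * f z))\<^sup>2) \<longleftrightarrow>
          integrable circle_measure (\<lambda>z. (cmod (\<phi> z * g z))\<^sup>2)"
      by (intro integrable_cong_AE) (use AE in auto)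
    then show ?thesis by (simp add: square_integrable_def)
  qed
  then show "L2_rel
     (if \<phi> \<in> borel_measurable circle_measure \<and> square_integrable (\<lambda>z. \<phi> z * f z)
      then (\<lambda>z. \<phi> z * f z) else (\<lambda>_. 0))
     (if \<phi> \<in> borel_measurable circle_measure \<and> square_integrable (\<lambda>z. \<phi> z * g z)
      then (\<lambda>z. \<phi> z * g z) else (\<lambda>_. 0))"
    using AE by (auto simp: L2_rel_def square_integrable_zero)
qed

definition Linfty :: "(complex \<Rightarrow> complex) set" where
  "Linfty = {\<phi> \<in> borel_measurable circle_measure. \<exists>C. AE z in circle_measure. cmod (\<phi> z) \<le> C}"

definition fourier :: "circle_L2 \<Rightarrow> int \<Rightarrow> complex" where
  "fourier f n = (LINT z|circle_measure. rep_circle_L2 f z * cnj (z powi n))"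

definition Hardy2 :: "circle_L2 set" where
  "Hardy2 = {f. \<forall>n<0. fourier f n = 0}"

text \<open>The value at \<open>w\<close> (with \<open>|w| < 1\<close>) of \<open>f \<in> H\<^sup>2\<close> viewed as an analytic function on the disk.\<close>

definition hardy_eval :: "circle_L2 \<Rightarrow> complex \<Rightarrow> complex" where
  "hardy_eval f w = (\<Sum>n. fourier f (int n) * w ^ n)"

definition backward_shift :: "circle_L2 \<Rightarrow> circle_L2" where
  "backward_shift f = mult_op (\<lambda>z. 1 / z) (f - const_L2 (hardy_eval f 0))"

text \<open>
  An inner function is identified with its boundary function; an element of \<open>H\<^sup>2\<close> that is
  unimodular almost everywhere on the circle is automatically bounded on the disk.
\<close>

definition inner_function :: "circle_L2 \<Rightarrow> bool" where
  "inner_function u \<longleftrightarrow> u \<in> Hardy2 \<and> (AE z in circle_measure. cmod (rep_circle_L2 u z) = 1)"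

definition model_space :: "circle_L2 \<Rightarrow> circle_L2 set" where
  "model_space u = Hardy2 \<inter> ortho (mult_op (rep_circle_L2 u) ` Hardy2)"

definition nearly_invariant :: "circle_L2 set \<Rightarrow> bool" where
  "nearly_invariant M \<longleftrightarrow> csubspace M \<and> closed M \<and> M \<subseteq> Hardy2 \<and>
     (\<forall>f\<in>M. hardy_eval f 0 = 0 \<longrightarrow> backward_shift f \<in> M)"

definition isometric_mult_onto :: "circle_L2 \<Rightarrow> circle_L2 set \<Rightarrow> circle_L2 set \<Rightarrow> bool" where
  "isometric_mult_onto h K M \<longleftrightarrow>
     (\<forall>k\<in>K. square_integrable (\<lambda>z. rep_circle_L2 h z * rep_circle_L2 k z) \<and>
            norm (mult_op (rep_circle_L2 h) k) = norm k) \<and>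
     mult_op (rep_circle_L2 h) ` K = M"

definition extremal_function :: "circle_L2 set \<Rightarrow> circle_L2 \<Rightarrow> bool" where
  "extremal_function M h \<longleftrightarrow> h \<in> M \<and> norm h = 1 \<and>
     hardy_eval h 0 \<in> \<real> \<and> Re (hardy_eval h 0) > 0 \<and>
     h \<in> ortho {f \<in> M. hardy_eval f 0 = 0}"

definition dual_toeplitz :: "circle_L2 set \<Rightarrow> (complex \<Rightarrow> complex) \<Rightarrow> circle_L2 \<Rightarrow> circle_L2" where
  "dual_toeplitz M \<phi> f = proj (ortho M) (mult_op \<phi> f)"

definition trunc_hankel ::
    "circle_L2 set \<Rightarrow> circle_L2 \<Rightarrow> (complex \<Rightarrow> complex) \<Rightarrow> circle_L2 \<Rightarrow> circle_L2" where
  "trunc_hankel M h \<phi> k = proj (ortho M) (mult_op \<phi> (mult_op (rep_circle_L2 h) k))"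

end

theory Submission
  imports Defs
begin

text \<open>
  Let \<open>P\<close> be the orthogonal projection onto the complement of \<open>M\<close> and let \<open>\<psi>\<close> be the
  complex conjugate of \<open>\<phi>\<close>. Then \<open>D\<^sub>\<phi>\<^sup>* = D\<^sub>\<psi>\<close> (\<open>adjoint_dual_toeplitz\<close>), and on the
  complement of \<open>M\<close>
  \<open>D\<^sub>\<phi> D\<^sub>\<psi> = P M\<^sub>\<phi> P M\<^sub>\<psi> = P M\<^sub>\<phi> M\<^sub>\<psi> - P M\<^sub>\<phi> (1 - P) M\<^sub>\<psi>\<close>.
  The first term on the right is the dual Toeplitz operator with symbol \<open>|\<phi>|\<^sup>2\<close>. In the
  second, \<open>1 - P\<close> is the projection onto \<open>M\<close>, which equals \<open>V V\<^sup>*\<close> because multiplication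
  by \<open>h\<close> is an isometry \<open>V\<close> of the model space onto \<open>M\<close>; so this term is
  \<open>(P M\<^sub>\<phi> V) (P M\<^sub>\<phi> V)\<^sup>* = H\<^sub>\<phi> H\<^sub>\<phi>\<^sup>*\<close> (\<open>trunc_hankel_adjoint\<close>). This is the first identity,
  and the second is the first with \<open>\<psi>\<close> in place of \<open>\<phi>\<close>.

  Behind these two lines stands the existence of the projection and of the adjoints, that
  is, the completeness of \<open>L\<^sup>2\<close> of the circle. It yields the projection by the
  nearest-point argument; the adjoints are then compressions of multiplication by \<open>\<psi>\<close>,
  pulled back along \<open>V\<close> in the case of \<open>H\<^sub>\<phi>\<close>.
\<close>

section \<open>The inner product on \<open>L\<^sup>2\<close> of the circle\<close>

lemma square_integrable_rep: "square_integrable (rep_circle_L2 f)"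
  using Quotient_rep_reflp[OF Quotient_circle_L2, of f] by (simp add: L2_rel_def)

lemma borel_measurable_rep_circle_L2:
  "rep_circle_L2 f \<in> borel_measurable circle_measure"
  using square_integrable_rep[of f] by (simp add: square_integrable_def)

lemma L2_rel_refl_iff: "L2_rel f f \<longleftrightarrow> square_integrable f"
  by (simp add: L2_rel_def)

lemma abs_rep_circle_L2: "abs_circle_L2 (rep_circle_L2 f) = f"
  by (rule Quotient_abs_rep[OF Quotient_circle_L2])

lemma circle_L2_cases:
  obtains f where "square_integrable f" "x = abs_circle_L2 f"
  using square_integrable_rep abs_rep_circle_L2 by metis

lemma cinner_commute: "cinner g f = cnj (cinner f g)"
proof transfer
  fix f g :: "complex \<Rightarrow> complex"
  show "(LINT z|circle_measure. g z * cnj (f z)) = cnj (LINT z|circle_measure. f z * cnj (g z))"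
    using Bochner_Integration.integral_cnj[of circle_measure "\<lambda>z. f z * cnj (g z)"]
    by (simp add: mult.commute)
qed

lemma cinner_add_left: "cinner (f + g) k = cinner f k + cinner g k"
proof transfer
  fix f g k assume "L2_rel f f" "L2_rel g g" "L2_rel k k"
  then show "(LINT z|circle_measure. (f z + g z) * cnj (k z)) =
      (LINT z|circle_measure. f z * cnj (k z)) + (LINT z|circle_measure. g z * cnj (k z))"
    by (subst Bochner_Integration.integral_add [symmetric])
      (auto simp: L2_rel_def algebra_simps intro!: square_integrable_mult_cnj_integrable)
qed

lemma cinner_cscale_left: "cinner (cscale c f) g = c * cinner f g"
  by transfer (simp add: mult.assoc)

lemma cinner_diff_left: "cinner (f - g) k = cinner f k - cinner g k"
  using cinner_add_left[of "f - g" g k] by simp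

lemma cinner_diff_right: "cinner k (f - g) = cinner k f - cinner k g"
  by (metis cinner_diff_left cinner_commute complex_cnj_diff)

lemma cinner_cscale_right: "cinner g (cscale c f) = cnj c * cinner g f"
  by (metis cinner_cscale_left cinner_commute complex_cnj_mult)

lemma cinner_zero_left [simp]: "cinner 0 f = 0"
  using cinner_diff_left[of 0 0 f] by simp

lemma cinner_self_eq_0D: "cinner f f = 0 \<Longrightarrow> f = 0"
  by (metis inner_circle_L2_def inner_eq_zero_iff zero_complex.sel(1))

text \<open>The real inner product determines the complex one, since
  \<open>Im \<langle>f, g\<rangle> = Re \<langle>f, i g\<rangle>\<close>. Facts about real inner product spaces transfer in this way.\<close>

lemma cinner_eq_inner: "cinner f g = Complex (inner f g) (inner f (cscale \<i> g))"
  by (simp add: inner_circle_L2_def cinner_cscale_right complex_eq_iff)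

lemma norm_abs_circle_L2_sq:
  assumes "square_integrable f"
  shows "(norm (abs_circle_L2 f))\<^sup>2 = (LINT z|circle_measure. (cmod (f z))\<^sup>2)"
proof -
  have "cinner (abs_circle_L2 f) (abs_circle_L2 f)
      = complex_of_real (LINT z|circle_measure. (cmod (f z))\<^sup>2)"
    using assms by (simp add: cinner.abs_eq L2_rel_refl_iff
        complex_norm_square[symmetric] flip: integral_complex_of_real)
  then show ?thesis
    by (simp add: power2_norm_eq_inner inner_circle_L2_def)
qed

text \<open>The Cauchy--Schwarz inequality for \<open>|f|\<close> and the constant \<open>1\<close>: convergence in
  \<open>L\<^sup>2\<close> implies convergence in \<open>L\<^sup>1\<close>.\<close>

lemma integral_cmod_le_norm:
  assumes "square_integrable f"
  shows "(LINT z|circle_measure. cmod (f z)) \<le> norm (abs_circle_L2 f) * norm (const_L2 1)"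
proof -
  define a where "a = (\<lambda>z. complex_of_real (cmod (f z)))"
  have [measurable]: "f \<in> borel_measurable circle_measure"
    using assms by (auto simp: square_integrable_def)
  have a: "square_integrable a"
    using assms by (simp add: square_integrable_def a_def)
  have "cinner (abs_circle_L2 a) (const_L2 1) = complex_of_real (LINT z|circle_measure. cmod (f z))"
    using a square_integrable_const[of 1]
    by (simp add: const_L2.abs_eq cinner.abs_eq L2_rel_refl_iff a_def)
  then have "(LINT z|circle_measure. cmod (f z)) = inner (abs_circle_L2 a) (const_L2 1)"
    by (simp add: inner_circle_L2_def)
  also have "\<dots> \<le> norm (abs_circle_L2 a) * norm (const_L2 1)"
    by (rule norm_cauchy_schwarz)
  also have "(norm (abs_circle_L2 a))\<^sup>2 = (norm (abs_circle_L2 f))\<^sup>2"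
    using assms a by (simp add: norm_abs_circle_L2_sq a_def)
  then have "norm (abs_circle_L2 a) = norm (abs_circle_L2 f)"
    by simp
  finally show ?thesis .
qed

section \<open>Completeness of the space of square-integrable functions\<close>

text \<open>Fatou's lemma: an \<open>L\<^sup>2\<close> bound that holds along the sequence survives an
  almost everywhere limit.\<close>

lemma square_integrable_AE_limit:
  assumes s: "\<And>i. square_integrable (s i)"
    and F [measurable]: "F \<in> borel_measurable circle_measure"
    and lim: "AE z in circle_measure. (\<lambda>i. s i z) \<longlonglongrightarrow> F z"
    and bd: "\<forall>\<^sub>F i in sequentially. (LINT z|circle_measure. (cmod (s i z))\<^sup>2) \<le> B"
  shows "square_integrable F" "(LINT z|circle_measure. (cmod (F z))\<^sup>2) \<le> B"
proof -
  have [measurable]: "s i \<in> borel_measurable circle_measure" for i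
    using s by (auto simp: square_integrable_def)
  have nn: "(\<integral>\<^sup>+ z. ennreal ((cmod (s i z))\<^sup>2) \<partial>circle_measure)
      = ennreal (LINT z|circle_measure. (cmod (s i z))\<^sup>2)" for i
    using s by (intro nn_integral_eq_integral) (auto simp: square_integrable_def)
  have B: "B \<ge> 0"
  proof -
    obtain i where "(LINT z|circle_measure. (cmod (s i z))\<^sup>2) \<le> B"
      using eventually_happens'[OF sequentially_bot bd] by auto
    moreover have "(LINT z|circle_measure. (cmod (s i z))\<^sup>2) \<ge> 0"
      by simp
    ultimately show ?thesis
      by linarith
  qed
  have "AE z in circle_measure.
      ennreal ((cmod (F z))\<^sup>2) = liminf (\<lambda>i. ennreal ((cmod (s i z))\<^sup>2))"
    using lim
  proof eventually_elim
    case (elim z)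
    then have "(\<lambda>i. ennreal ((cmod (s i z))\<^sup>2)) \<longlonglongrightarrow> ennreal ((cmod (F z))\<^sup>2)"
      by (intro tendsto_intros)
    then show ?case
      by (metis lim_imp_Liminf sequentially_bot)
  qed
  then have "(\<integral>\<^sup>+ z. ennreal ((cmod (F z))\<^sup>2) \<partial>circle_measure)
      = (\<integral>\<^sup>+ z. liminf (\<lambda>i. ennreal ((cmod (s i z))\<^sup>2)) \<partial>circle_measure)"
    by (rule nn_integral_cong_AE)
  also have "\<dots> \<le> liminf (\<lambda>i. \<integral>\<^sup>+ z. ennreal ((cmod (s i z))\<^sup>2) \<partial>circle_measure)"
    by (rule nn_integral_liminf) simp
  also have "\<dots> \<le> liminf (\<lambda>i. ennreal B)"
    using bd unfolding nn by (intro Liminf_mono) (auto elim!: eventually_mono intro: ennreal_leI)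
  also have "\<dots> = ennreal B"
    by (simp add: Liminf_const)
  finally have le: "(\<integral>\<^sup>+ z. ennreal ((cmod (F z))\<^sup>2) \<partial>circle_measure) \<le> ennreal B" .
  then have int: "integrable circle_measure (\<lambda>z. (cmod (F z))\<^sup>2)"
    by (intro integrableI_bounded) (auto simp: le_less_trans)
  then show "square_integrable F"
    by (simp add: square_integrable_def)
  show "(LINT z|circle_measure. (cmod (F z))\<^sup>2) \<le> B"
    using le nn_integral_eq_integral[OF int] B by simp
qed

text \<open>Riesz--Fischer. As the circle has finite measure, an \<open>L\<^sup>2\<close>-Cauchy sequence is
  \<open>L\<^sup>1\<close>-Cauchy, so a subsequence converges almost everywhere; Fatou's lemma applied to
  \<open>X\<^sub>n - X\<^sub>r\<^sub>(\<^sub>i\<^sub>)\<close> as \<open>i \<rightarrow> \<infinity>\<close> turns this into convergence in \<open>L\<^sup>2\<close>.\<close>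

instance circle_L2 :: complete_space
proof
  fix X :: "nat \<Rightarrow> circle_L2"
  assume X: "Cauchy X"
  define s where "s = (\<lambda>n. rep_circle_L2 (X n))"
  have s: "square_integrable (s n)" for n
    by (simp add: s_def square_integrable_rep)
  have [measurable]: "s n \<in> borel_measurable circle_measure" for n
    using s by (auto simp: square_integrable_def)
  have abs_s: "abs_circle_L2 (s n) = X n" for n
    by (simp add: s_def abs_rep_circle_L2)
  have sd: "square_integrable (\<lambda>z. s m z - s n z)" for m n
    by (intro square_integrable_diff s)
  have abs_diff: "abs_circle_L2 (\<lambda>z. s m z - s n z) = X m - X n" for m n
    using s by (simp add: minus_circle_L2.abs_eq L2_rel_refl_iff flip: abs_s)
  have "\<exists>N. \<forall>i\<ge>N. \<forall>j\<ge>N. (LINT z|circle_measure. cmod (s i z - s j z)) < e" if "e > 0" for e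
  proof -
    define c where "c = norm (const_L2 1) + 1"
    have c: "c > 0"
      by (simp add: c_def add_nonneg_pos)
    obtain N where N: "\<And>i j. i \<ge> N \<Longrightarrow> j \<ge> N \<Longrightarrow> norm (X i - X j) < e / c"
      using X \<open>e > 0\<close> c unfolding Cauchy_iff by (meson divide_pos_pos)
    have "(LINT z|circle_measure. cmod (s i z - s j z)) < e" if "i \<ge> N" "j \<ge> N" for i j
    proof -
      have "(LINT z|circle_measure. cmod (s i z - s j z)) \<le> norm (X i - X j) * norm (const_L2 1)"
        using integral_cmod_le_norm[OF sd[of i j]] by (simp add: abs_diff)
      also have "\<dots> \<le> norm (X i - X j) * c"
        by (intro mult_left_mono) (auto simp: c_def)
      also have "\<dots> < e"
        using N[OF that] c by (simp add: field_simps)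
      finally show ?thesis .
    qed
    then show ?thesis by blast
  qed
  moreover have "integrable circle_measure (s n)" for n
    using square_integrable_mult_cnj_integrable[OF s[of n] square_integrable_const[of 1]] by simp
  ultimately obtain r where r: "strict_mono r"
      and Cauchy: "AE z in circle_measure. Cauchy (\<lambda>i. s (r i) z)"
    using cauchy_L1_AE_cauchy_subseq[of circle_measure s] by blast
  define F where "F = (\<lambda>z. lim (\<lambda>i. s (r i) z))"
  have F [measurable]: "F \<in> borel_measurable circle_measure"
    unfolding F_def by measurable
  have lim: "AE z in circle_measure. (\<lambda>i. s (r i) z) \<longlonglongrightarrow> F z"
    using Cauchy by eventually_elim (simp add: F_def Cauchy_convergent convergent_LIMSEQ_iff[symmetric])
  have key: "square_integrable (\<lambda>z. s n z - F z) \<and>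
        (LINT z|circle_measure. (cmod (s n z - F z))\<^sup>2) \<le> e\<^sup>2"
    if close: "\<And>i. i \<ge> N \<Longrightarrow> norm (X n - X i) < e" for n N e
  proof -
    have "(LINT z|circle_measure. (cmod (s n z - s (r i) z))\<^sup>2) \<le> e\<^sup>2" if "i \<ge> N" for i
    proof -
      have "norm (X n - X (r i)) < e"
        using \<open>i \<ge> N\<close> seq_suble[OF r, of i] by (intro close) simp
      then show ?thesis
        using norm_abs_circle_L2_sq[OF sd[of n "r i"]] power_mono[of "norm (X n - X (r i))" e 2]
        by (simp add: abs_diff)
    qed
    then have ev: "\<forall>\<^sub>F i in sequentially.
        (LINT z|circle_measure. (cmod (s n z - s (r i) z))\<^sup>2) \<le> e\<^sup>2"
      by (auto simp: eventually_sequentially)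
    have "AE z in circle_measure. (\<lambda>i. s n z - s (r i) z) \<longlonglongrightarrow> s n z - F z"
      using lim by eventually_elim (intro tendsto_intros)
    then show ?thesis
      using square_integrable_AE_limit[OF sd _ _ ev, of "\<lambda>z. s n z - F z"] by simp
  qed
  have Fsq: "square_integrable F"
  proof -
    obtain N where "\<And>i. i \<ge> N \<Longrightarrow> norm (X N - X i) < 1"
      using X unfolding Cauchy_iff by (meson order_refl zero_less_one)
    then have "square_integrable (\<lambda>z. s N z - F z)"
      using key by blast
    then show ?thesis
      using square_integrable_diff[OF s[of N], of "\<lambda>z. s N z - F z"] by simp
  qed
  have abs_diffF: "abs_circle_L2 (\<lambda>z. s n z - F z) = X n - abs_circle_L2 F" for n
    using s Fsq by (simp add: minus_circle_L2.abs_eq L2_rel_refl_iff flip: abs_s)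
  have "X \<longlonglongrightarrow> abs_circle_L2 F"
  proof (rule LIMSEQ_I)
    fix e :: real assume "e > 0"
    then obtain N where N: "\<And>i j. i \<ge> N \<Longrightarrow> j \<ge> N \<Longrightarrow> norm (X i - X j) < e / 2"
      using X unfolding Cauchy_iff by (meson half_gt_zero)
    have "norm (X n - abs_circle_L2 F) < e" if "n \<ge> N" for n
    proof -
      have "square_integrable (\<lambda>z. s n z - F z) \<and>
          (LINT z|circle_measure. (cmod (s n z - F z))\<^sup>2) \<le> (e / 2)\<^sup>2"
        using key[of N n "e / 2"] N that by blast
      then have "(norm (X n - abs_circle_L2 F))\<^sup>2 \<le> (e / 2)\<^sup>2"
        using norm_abs_circle_L2_sq[of "\<lambda>z. s n z - F z"] by (simp add: abs_diffF)
      then have "norm (X n - abs_circle_L2 F) \<le> e / 2"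
        by (rule power2_le_imp_le) (use \<open>e > 0\<close> in simp)
      then show ?thesis
        using \<open>e > 0\<close> by linarith
    qed
    then show "\<exists>N. \<forall>n\<ge>N. norm (X n - abs_circle_L2 F) < e"
      by blast
  qed
  then show "convergent X"
    by (auto simp: convergent_def)
qed

section \<open>Orthogonal projections\<close>

text \<open>The nearest-point argument: by the parallelogram law a minimizing sequence for the
  distance from \<open>x\<close> to \<open>S\<close> is Cauchy, and the residual at a nearest point is orthogonal
  to \<open>S\<close>, since otherwise a small move along \<open>S\<close> would bring the point closer.\<close>

lemma closed_subspace_orthogonal_decomposition:
  fixes S :: "'a :: {real_inner, complete_space} set"
  assumes S: "subspace S" "closed S"
  obtains m where "m \<in> S" "\<And>g. g \<in> S \<Longrightarrow> inner (x - m) g = 0"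
proof -
  define d where "d = infdist x S"
  have ne: "S \<noteq> {}"
    using S subspace_0 by auto
  have d0: "d \<ge> 0"
    by (simp add: d_def infdist_nonneg)
  have dle: "d\<^sup>2 \<le> (norm (x - a))\<^sup>2" if "a \<in> S" for a
    using infdist_le[OF that, of x] d0 by (intro power_mono) (auto simp: d_def dist_norm)
  have "\<exists>a\<in>S. (norm (x - a))\<^sup>2 < d\<^sup>2 + 1 / real (Suc n)" for n
  proof -
    have "d < sqrt (d\<^sup>2 + 1 / real (Suc n))"
      using d0 by (intro real_less_rsqrt) simp
    then obtain a where a: "a \<in> S" "dist x a < sqrt (d\<^sup>2 + 1 / real (Suc n))"
      unfolding d_def infdist_notempty[OF ne]
      by (subst (asm) cINF_less_iff) (use ne in auto)
    have "(norm (x - a))\<^sup>2 < (sqrt (d\<^sup>2 + 1 / real (Suc n)))\<^sup>2"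
      using a(2) by (intro power_strict_mono) (auto simp: dist_norm)
    also have "\<dots> = d\<^sup>2 + 1 / real (Suc n)"
      by simp
    finally show ?thesis
      using a(1) by blast
  qed
  then obtain s where s: "\<And>n. s n \<in> S" "\<And>n. (norm (x - s n))\<^sup>2 < d\<^sup>2 + 1 / real (Suc n)"
    by metis
  have sdist: "(norm (s i - s j))\<^sup>2 \<le> 2 / real (Suc i) + 2 / real (Suc j)" for i j
  proof -
    define c where "c = (1 / 2) *\<^sub>R (s i + s j)"
    have "c \<in> S"
      unfolding c_def using S s by (intro subspace_scale subspace_add) auto
    then have "d\<^sup>2 \<le> (norm (x - c))\<^sup>2"
      by (rule dle)
    moreover have "(norm (s i - s j))\<^sup>2
        = 2 * (norm (x - s i))\<^sup>2 + 2 * (norm (x - s j))\<^sup>2 - 4 * (norm (x - c))\<^sup>2"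
      unfolding power2_norm_eq_inner c_def
      by (simp add: inner_diff_left inner_diff_right inner_add_left inner_add_right
          inner_commute algebra_simps)
    ultimately show ?thesis
      using s(2)[of i] s(2)[of j] by (simp add: algebra_simps)
  qed
  have "Cauchy s"
    unfolding Cauchy_iff
  proof (intro allI impI)
    fix e :: real assume "e > 0"
    then obtain N where N: "inverse (real (Suc N)) < e\<^sup>2 / 4"
      using reals_Archimedean[of "e\<^sup>2 / 4"] by auto
    have "norm (s i - s j) < e" if "i \<ge> N" "j \<ge> N" for i j
    proof -
      have "2 / real (Suc k) < e\<^sup>2 / 2" if "k \<ge> N" for k
      proof -
        have "inverse (real (Suc k)) \<le> inverse (real (Suc N))"
          using that by (intro le_imp_inverse_le) auto
        then have "inverse (real (Suc k)) < e\<^sup>2 / 4"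
          using N by linarith
        moreover have "2 / real (Suc k) = 2 * inverse (real (Suc k))"
          by (rule divide_inverse)
        ultimately show ?thesis
          by linarith
      qed
      from this[OF that(1)] this[OF that(2)] have "(norm (s i - s j))\<^sup>2 < e\<^sup>2"
        using sdist[of i j] by linarith
      then show ?thesis
        by (rule power2_less_imp_less) (use \<open>e > 0\<close> in simp)
    qed
    then show "\<exists>M. \<forall>m\<ge>M. \<forall>n\<ge>M. norm (s m - s n) < e"
      by blast
  qed
  then obtain m where m: "s \<longlonglongrightarrow> m"
    using Cauchy_convergent convergent_def by blast
  have mS: "m \<in> S"
    using closed_sequentially[OF S(2)] s(1) m by blast
  have "(norm (x - m))\<^sup>2 \<le> d\<^sup>2"
  proof (rule LIMSEQ_le)
    show "(\<lambda>n. (norm (x - s n))\<^sup>2) \<longlonglongrightarrow> (norm (x - m))\<^sup>2"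
      by (intro tendsto_intros m)
    show "(\<lambda>n. d\<^sup>2 + 1 / real (Suc n)) \<longlonglongrightarrow> d\<^sup>2"
      using LIMSEQ_inverse_real_of_nat_add[of "d\<^sup>2"] by (simp only: inverse_eq_divide)
    show "\<exists>N. \<forall>n\<ge>N. (norm (x - s n))\<^sup>2 \<le> d\<^sup>2 + 1 / real (Suc n)"
      using s(2) less_imp_le by blast
  qed
  then have min: "(norm (x - m))\<^sup>2 \<le> (norm (x - a))\<^sup>2" if "a \<in> S" for a
    using dle[OF that] by linarith
  have "inner (x - m) g = 0" if g: "g \<in> S" for g
  proof (cases "g = 0")
    case False
    then have pos: "inner g g > 0"
      by simp
    \<comment> \<open>the value of \<open>t\<close> at which \<open>m + t g\<close> is nearest to \<open>x\<close>\<close>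
    define t where "t = inner (x - m) g / inner g g"
    have "m + t *\<^sub>R g \<in> S"
      using S mS g by (intro subspace_add subspace_scale)
    then have "(norm (x - m))\<^sup>2 \<le> (norm ((x - m) - t *\<^sub>R g))\<^sup>2"
      using min by (simp add: diff_diff_eq)
    also have "\<dots> = (norm (x - m))\<^sup>2 - 2 * t * inner (x - m) g + t * t * inner g g"
      unfolding power2_norm_eq_inner
      by (simp add: inner_diff_left[of "x - m"] inner_diff_right[of _ "x - m"]
          inner_commute algebra_simps)
    also have "t * t * inner g g = t * inner (x - m) g"
      using pos by (simp add: t_def)
    finally have "(inner (x - m) g)\<^sup>2 / inner g g \<le> 0"
      by (simp add: t_def power2_eq_square)
    then show ?thesis
      using pos by (simp add: divide_le_0_iff)
  qed simp
  with mS show thesis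
    by (rule that)
qed

lemma csubspace_minus: "csubspace A \<Longrightarrow> f \<in> A \<Longrightarrow> g \<in> A \<Longrightarrow> f - g \<in> A"
proof -
  assume A: "csubspace A" "f \<in> A" "g \<in> A"
  have "cscale (- 1) g = - g"
    using scaleR_minus1_left[of g] by (simp add: scaleR_circle_L2_def)
  then have "- g \<in> A"
    using A unfolding csubspace_def by metis
  then show ?thesis
    using A unfolding csubspace_def by (metis add_uminus_conv_diff)
qed

lemma csubspace_imp_subspace: "csubspace A \<Longrightarrow> subspace A"
  by (simp add: csubspace_def subspace_def scaleR_circle_L2_def)

lemma csubspace_ortho: "csubspace (ortho A)"
  by (simp add: csubspace_def ortho_def cinner_add_left cinner_cscale_left)

lemma ortho_cinner_eq_0: "f \<in> ortho A \<Longrightarrow> a \<in> A \<Longrightarrow> cinner a f = 0"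
  using cinner_commute[of a f] by (simp add: ortho_def)

text \<open>The description of \<open>proj (ortho M) f\<close> asks for a residual in \<open>ortho (ortho M)\<close>. If
  \<open>m\<close> is the component of \<open>f\<close> in \<open>M\<close>, then \<open>f - m\<close> is as required because \<open>M\<close> is
  contained in \<open>ortho (ortho M)\<close>; it is the only such vector because the difference of
  two of them would be orthogonal to itself.\<close>

lemma proj_ortho:
  assumes M: "csubspace M" "closed M"
  shows "proj (ortho M) f \<in> ortho M" "f - proj (ortho M) f \<in> M"
proof -
  obtain m where m: "m \<in> M" "\<And>g. g \<in> M \<Longrightarrow> inner (f - m) g = 0"
    using closed_subspace_orthogonal_decomposition[OF csubspace_imp_subspace[OF M(1)] M(2)] by metis
  have "cscale \<i> g \<in> M" if "g \<in> M" for g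
    using M(1) that by (simp add: csubspace_def)
  then have fm: "f - m \<in> ortho M"
    using m(2) by (simp add: ortho_def cinner_eq_inner complex_eq_iff)
  have "proj (ortho M) f = f - m"
    unfolding proj_def
  proof (rule the_equality)
    show "f - m \<in> ortho M \<and> f - (f - m) \<in> ortho (ortho M)"
      using fm m(1) ortho_cinner_eq_0 by (auto simp: ortho_def[of "ortho M"])
  next
    fix g assume g: "g \<in> ortho M \<and> f - g \<in> ortho (ortho M)"
    define e where "e = (f - m) - g"
    have e: "e \<in> ortho M"
      unfolding e_def using g by (intro csubspace_minus[OF csubspace_ortho] fm) simp
    have "cinner e e = cinner (f - g) e - cinner m e"
      by (simp add: e_def cinner_diff_left)
    also have "cinner (f - g) e = 0"
      using g e by (simp add: ortho_def[of "ortho M"])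
    also have "cinner m e = 0"
      using e m(1) by (rule ortho_cinner_eq_0)
    finally have "e = 0"
      by (intro cinner_self_eq_0D) simp
    then show "g = f - m"
      by (simp add: e_def)
  qed
  then show "proj (ortho M) f \<in> ortho M" "f - proj (ortho M) f \<in> M"
    using fm m(1) by simp_all
qed

lemma proj_ortho_unique:
  assumes M: "csubspace M" "closed M" and g: "g \<in> ortho M" "f - g \<in> M"
  shows "proj (ortho M) f = g"
proof -
  define e where "e = proj (ortho M) f - g"
  have "e \<in> ortho M"
    unfolding e_def by (intro csubspace_minus[OF csubspace_ortho] proj_ortho M g)
  moreover have "e = (f - g) - (f - proj (ortho M) f)"
    by (simp add: e_def)
  then have "e \<in> M"
    using proj_ortho[OF M] g M(1) by (metis csubspace_minus)
  ultimately have "e = 0"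
    by (intro cinner_self_eq_0D) (simp add: ortho_def)
  then show ?thesis
    by (simp add: e_def)
qed

lemma proj_ortho_diff:
  assumes M: "csubspace M" "closed M"
  shows "proj (ortho M) (f - g) = proj (ortho M) f - proj (ortho M) g"
proof (rule proj_ortho_unique[OF M])
  show "proj (ortho M) f - proj (ortho M) g \<in> ortho M"
    by (intro csubspace_minus[OF csubspace_ortho] proj_ortho M)
  have "(f - proj (ortho M) f) - (g - proj (ortho M) g) \<in> M"
    by (intro csubspace_minus[OF M(1)] proj_ortho M)
  then show "f - g - (proj (ortho M) f - proj (ortho M) g) \<in> M"
    by (simp add: algebra_simps)
qed

lemma cinner_proj_ortho:
  assumes M: "csubspace M" "closed M" and "g \<in> ortho M"
  shows "cinner (proj (ortho M) f) g = cinner f g"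
  using ortho_cinner_eq_0[OF assms(3) proj_ortho(2)[OF M, of f]] by (simp add: cinner_diff_left)

text \<open>Uniqueness in the description of the adjoint: the difference of two candidates lies
  in \<open>A\<close> and is orthogonal to \<open>A\<close>.\<close>

lemma adjoint_on_eqI:
  assumes A: "csubspace A" and x: "x \<in> A" "\<And>a. a \<in> A \<Longrightarrow> cinner (T a) y = cinner a x"
  shows "adjoint_on A T y = x"
  unfolding adjoint_on_def
proof (rule the_equality)
  fix x' assume x': "x' \<in> A \<and> (\<forall>a\<in>A. cinner (T a) y = cinner a x')"
  have "x' - x \<in> A"
    using x(1) x' by (intro csubspace_minus[OF A]) auto
  then have "cinner (x' - x) (x' - x) = 0"
    using x(2) x' by (simp add: cinner_diff_right)
  then show "x' = x"
    using cinner_self_eq_0D by fastforce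
qed (use x in blast)

section \<open>Multiplication operators\<close>

lemma square_integrable_Linfty_mult:
  assumes "\<phi> \<in> Linfty" "square_integrable f"
  shows "square_integrable (\<lambda>z. \<phi> z * f z)"
proof -
  have [measurable]: "\<phi> \<in> borel_measurable circle_measure" "f \<in> borel_measurable circle_measure"
    using assms by (auto simp: Linfty_def square_integrable_def)
  obtain C where "AE z in circle_measure. cmod (\<phi> z) \<le> C"
    using assms by (auto simp: Linfty_def)
  then have "AE z in circle_measure. norm ((cmod (\<phi> z * f z))\<^sup>2) \<le> norm (C\<^sup>2 * (cmod (f z))\<^sup>2)"
    by eventually_elim (auto simp: norm_mult power_mult_distrib intro!: mult_right_mono power_mono)
  moreover have "integrable circle_measure (\<lambda>z. C\<^sup>2 * (cmod (f z))\<^sup>2)"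
    using assms by (simp add: square_integrable_def)
  moreover have "(\<lambda>z. (cmod (\<phi> z * f z))\<^sup>2) \<in> borel_measurable circle_measure"
    by measurable
  ultimately have "integrable circle_measure (\<lambda>z. (cmod (\<phi> z * f z))\<^sup>2)"
    using Bochner_Integration.integrable_bound by blast
  then show ?thesis
    by (simp add: square_integrable_def)
qed

lemma Linfty_cnj: "\<phi> \<in> Linfty \<Longrightarrow> (\<lambda>z. cnj (\<phi> z)) \<in> Linfty"
  by (auto simp: Linfty_def)

lemma mult_op_abs_circle_L2:
  assumes "\<phi> \<in> borel_measurable circle_measure" "square_integrable f"
    "square_integrable (\<lambda>z. \<phi> z * f z)"
  shows "mult_op \<phi> (abs_circle_L2 f) = abs_circle_L2 (\<lambda>z. \<phi> z * f z)"
  using assms by (simp add: mult_op.abs_eq L2_rel_refl_iff)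

lemma mult_op_Linfty_abs:
  assumes "\<phi> \<in> Linfty" "square_integrable f"
  shows "mult_op \<phi> (abs_circle_L2 f) = abs_circle_L2 (\<lambda>z. \<phi> z * f z)"
  using assms by (intro mult_op_abs_circle_L2 square_integrable_Linfty_mult) (auto simp: Linfty_def)

lemma mult_op_diff:
  assumes "\<phi> \<in> Linfty"
  shows "mult_op \<phi> (f - g) = mult_op \<phi> f - mult_op \<phi> g"
proof -
  obtain F G where [simp]: "square_integrable F" "square_integrable G"
    and fg: "f = abs_circle_L2 F" "g = abs_circle_L2 G"
    by (metis circle_L2_cases)
  show ?thesis
    unfolding fg using assms
    by (simp add: minus_circle_L2.abs_eq L2_rel_refl_iff mult_op_Linfty_abs square_integrable_diff
        square_integrable_Linfty_mult right_diff_distrib)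
qed

lemma mult_op_mult_op:
  assumes "\<phi> \<in> Linfty" "\<psi> \<in> Linfty"
  shows "mult_op \<phi> (mult_op \<psi> f) = mult_op (\<lambda>z. \<phi> z * \<psi> z) f"
proof -
  obtain F where F: "square_integrable F" and f: "f = abs_circle_L2 F"
    by (metis circle_L2_cases)
  have [measurable]: "\<phi> \<in> borel_measurable circle_measure" "\<psi> \<in> borel_measurable circle_measure"
    using assms by (auto simp: Linfty_def)
  have "square_integrable (\<lambda>z. \<phi> z * (\<psi> z * F z))"
    using assms F by (intro square_integrable_Linfty_mult)
  then show ?thesis
    unfolding f using assms F
    by (simp add: mult_op_Linfty_abs mult_op_abs_circle_L2 square_integrable_Linfty_mult mult.assoc)
qed

lemma cinner_mult_op:
  assumes "\<phi> \<in> Linfty"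
  shows "cinner (mult_op \<phi> f) g = cinner f (mult_op (\<lambda>z. cnj (\<phi> z)) g)"
proof -
  obtain F G where [simp]: "square_integrable F" "square_integrable G"
    and fg: "f = abs_circle_L2 F" "g = abs_circle_L2 G"
    by (metis circle_L2_cases)
  show ?thesis
    unfolding fg using assms Linfty_cnj[OF assms]
    by (simp add: cinner.abs_eq L2_rel_refl_iff mult_op_Linfty_abs
        square_integrable_Linfty_mult) (simp add: mult_ac)
qed

lemma mult_op_rep:
  assumes "square_integrable (\<lambda>z. rep_circle_L2 h z * rep_circle_L2 k z)"
  shows "mult_op (rep_circle_L2 h) k = abs_circle_L2 (\<lambda>z. rep_circle_L2 h z * rep_circle_L2 k z)"
  using mult_op_abs_circle_L2[of "rep_circle_L2 h" "rep_circle_L2 k"] assms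
  by (simp add: abs_rep_circle_L2 borel_measurable_rep_circle_L2 square_integrable_rep)

text \<open>An unbounded multiplier \<open>h\<close> is still additive on the functions that it keeps in
  \<open>L\<^sup>2\<close>.\<close>

lemma mult_op_rep_add:
  assumes k: "square_integrable (\<lambda>z. rep_circle_L2 h z * rep_circle_L2 k z)"
    and l: "square_integrable (\<lambda>z. rep_circle_L2 h z * rep_circle_L2 l z)"
  shows "mult_op (rep_circle_L2 h) (k + l)
    = mult_op (rep_circle_L2 h) k + mult_op (rep_circle_L2 h) l"
proof -
  let ?h = "rep_circle_L2 h" and ?k = "rep_circle_L2 k" and ?l = "rep_circle_L2 l"
  have sum: "square_integrable (\<lambda>z. ?h z * (?k z + ?l z))"
    using square_integrable_add[OF k l] by (simp add: distrib_left)
  have "k + l = abs_circle_L2 ?k + abs_circle_L2 ?l"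
    by (simp add: abs_rep_circle_L2)
  also have "\<dots> = abs_circle_L2 (\<lambda>z. ?k z + ?l z)"
    by (simp add: plus_circle_L2.abs_eq L2_rel_refl_iff square_integrable_rep)
  finally have "mult_op ?h (k + l) = abs_circle_L2 (\<lambda>z. ?h z * (?k z + ?l z))"
    by (simp add: mult_op_abs_circle_L2 sum borel_measurable_rep_circle_L2
        square_integrable_add square_integrable_rep)
  also have "\<dots> = mult_op ?h k + mult_op ?h l"
    using k l by (simp add: mult_op_rep plus_circle_L2.abs_eq L2_rel_refl_iff distrib_left)
  finally show ?thesis .
qed

lemma mult_op_rep_cscale:
  assumes k: "square_integrable (\<lambda>z. rep_circle_L2 h z * rep_circle_L2 k z)"
  shows "mult_op (rep_circle_L2 h) (cscale c k) = cscale c (mult_op (rep_circle_L2 h) k)"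
proof -
  let ?h = "rep_circle_L2 h" and ?k = "rep_circle_L2 k"
  have *: "square_integrable (\<lambda>z. ?h z * (c * ?k z))"
    using square_integrable_cmult[OF k, of c] by (simp add: mult_ac)
  have "cscale c k = cscale c (abs_circle_L2 ?k)"
    by (simp add: abs_rep_circle_L2)
  also have "\<dots> = abs_circle_L2 (\<lambda>z. c * ?k z)"
    by (simp add: cscale.abs_eq L2_rel_refl_iff square_integrable_rep)
  finally have "mult_op ?h (cscale c k) = abs_circle_L2 (\<lambda>z. ?h z * (c * ?k z))"
    by (simp add: mult_op_abs_circle_L2 * borel_measurable_rep_circle_L2
        square_integrable_cmult square_integrable_rep)
  also have "\<dots> = cscale c (mult_op ?h k)"
    using k by (simp add: mult_op_rep cscale.abs_eq L2_rel_refl_iff mult_ac)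
  finally show ?thesis .
qed

text \<open>Polarization: an isometric multiplication preserves the inner product.\<close>

lemma isometric_mult_onto_cinner:
  assumes K: "csubspace K" and iso: "isometric_mult_onto h K M" and k: "k \<in> K" "l \<in> K"
  shows "cinner (mult_op (rep_circle_L2 h) k) (mult_op (rep_circle_L2 h) l) = cinner k l"
proof -
  let ?V = "mult_op (rep_circle_L2 h)"
  have sq: "square_integrable (\<lambda>z. rep_circle_L2 h z * rep_circle_L2 x z)"
    and nrm: "norm (?V x) = norm x" if "x \<in> K" for x
    using iso that by (auto simp: isometric_mult_onto_def)
  have inner: "inner (?V x) (?V y) = inner x y" if "x \<in> K" "y \<in> K" for x y
  proof -
    have "x + y \<in> K"
      using K that by (simp add: csubspace_def)
    then have "norm (?V x + ?V y) = norm (x + y)"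
      using nrm[of "x + y"] mult_op_rep_add[OF sq sq] that by simp
    then show ?thesis
      using nrm that by (simp add: dot_norm)
  qed
  have il: "cscale \<i> l \<in> K"
    using K k by (simp add: csubspace_def)
  show ?thesis
    using inner[OF k] inner[OF k(1) il] mult_op_rep_cscale[OF sq[OF k(2)]]
    by (simp add: cinner_eq_inner)
qed

section \<open>Model spaces\<close>

lemma fourier_cinner:
  assumes "square_integrable (\<lambda>z. z powi n)"
  shows "fourier f n = cinner f (abs_circle_L2 (\<lambda>z. z powi n))"
proof -
  have "cinner (abs_circle_L2 (rep_circle_L2 f)) (abs_circle_L2 (\<lambda>z. z powi n)) = fourier f n"
    using assms by (simp add: cinner.abs_eq L2_rel_refl_iff square_integrable_rep fourier_def)
  then show ?thesis
    by (simp add: abs_rep_circle_L2)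
qed

lemma AE_circle_norm_1: "AE z in circle_measure. cmod z = 1"
proof -
  have "cis \<in> borel_measurable (uniform_measure lborel {0..2 * pi})"
    by (simp add: borel_measurable_continuous_onI continuous_intros cong: measurable_cong_sets)
  then show ?thesis
    unfolding circle_measure_def by (subst AE_distr_iff) auto
qed

lemma square_integrable_powi: "square_integrable (\<lambda>z. z powi n)"
proof -
  have [measurable]: "(\<lambda>z::complex. z powi n) \<in> borel_measurable circle_measure"
    by (cases "n \<ge> 0") (simp_all add: power_int_def)
  have "AE z in circle_measure. norm ((cmod (z powi n))\<^sup>2) \<le> norm (1 :: real)"
    using AE_circle_norm_1 by eventually_elim (simp add: norm_power_int)
  moreover have "integrable circle_measure (\<lambda>_. 1 :: real)"
    by (rule finite_measure.integrable_const[OF finite_measure_circle_measure])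
  moreover have "(\<lambda>z. (cmod (z powi n))\<^sup>2) \<in> borel_measurable circle_measure"
    by measurable
  ultimately have "integrable circle_measure (\<lambda>z. (cmod (z powi n))\<^sup>2)"
    using Bochner_Integration.integrable_bound by blast
  then show ?thesis
    by (simp add: square_integrable_def)
qed

text \<open>Fourier coefficients are inner products with fixed vectors, hence linear in \<open>f\<close>; so
  the Hardy space is a subspace.\<close>

lemma csubspace_model_space: "csubspace (model_space u)"
  using csubspace_ortho[of "mult_op (rep_circle_L2 u) ` Hardy2"]
  by (simp add: csubspace_def model_space_def Hardy2_def fourier_cinner square_integrable_powi
      cinner_add_left cinner_cscale_left)

section \<open>Dual truncated Toeplitz operators and Hankel operators\<close>

text \<open>\<open>D\<^sub>\<phi>\<close> is the compression of multiplication by \<open>\<phi>\<close> to the orthogonal complement of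
  \<open>M\<close>, so its adjoint is the compression of multiplication by the conjugate symbol.\<close>

lemma adjoint_dual_toeplitz:
  assumes M: "csubspace M" "closed M" and \<phi>: "\<phi> \<in> Linfty" and f: "f \<in> ortho M"
  shows "adjoint_on (ortho M) (dual_toeplitz M \<phi>) f = dual_toeplitz M (\<lambda>z. cnj (\<phi> z)) f"
proof (rule adjoint_on_eqI[OF csubspace_ortho])
  show "dual_toeplitz M (\<lambda>z. cnj (\<phi> z)) f \<in> ortho M"
    by (simp add: dual_toeplitz_def proj_ortho M)
  fix a assume a: "a \<in> ortho M"
  have "cinner (dual_toeplitz M \<phi> a) f = cinner (mult_op \<phi> a) f"
    by (simp add: dual_toeplitz_def cinner_proj_ortho M f)
  also have "\<dots> = cinner a (mult_op (\<lambda>z. cnj (\<phi> z)) f)"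
    by (rule cinner_mult_op[OF \<phi>])
  also have "\<dots> = cinner a (dual_toeplitz M (\<lambda>z. cnj (\<phi> z)) f)"
    by (metis a cinner_commute cinner_proj_ortho M dual_toeplitz_def)
  finally show "cinner (dual_toeplitz M \<phi> a) f = cinner a (dual_toeplitz M (\<lambda>z. cnj (\<phi> z)) f)" .
qed

text \<open>The isometry \<open>V\<close> drops out of \<open>H\<^sub>\<phi> H\<^sub>\<phi>\<^sup>*\<close>: as \<open>V\<close> maps \<open>K\<close> onto \<open>M\<close>, the product
  \<open>V V\<^sup>*\<close> is the orthogonal projection onto \<open>M\<close>. Concretely, \<open>H\<^sub>\<phi>\<^sup>* f\<close> is the
  \<open>V\<close>-preimage of the component in \<open>M\<close> of \<open>f\<close> times the conjugate of \<open>\<phi>\<close>.\<close>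

lemma trunc_hankel_adjoint:
  assumes M: "csubspace M" "closed M" and K: "csubspace K"
    and iso: "isometric_mult_onto h K M" and \<phi>: "\<phi> \<in> Linfty" and f: "f \<in> ortho M"
  defines "g \<equiv> mult_op (\<lambda>z. cnj (\<phi> z)) f"
  shows "trunc_hankel M h \<phi> (adjoint_on K (trunc_hankel M h \<phi>) f)
    = proj (ortho M) (mult_op \<phi> (g - proj (ortho M) g))"
proof -
  let ?V = "mult_op (rep_circle_L2 h)"
  have VK: "?V ` K = M"
    using iso by (simp add: isometric_mult_onto_def)
  obtain k where k: "k \<in> K" "?V k = g - proj (ortho M) g"
    using proj_ortho(2)[OF M, of g] unfolding VK[symmetric] by (metis imageE)
  have "adjoint_on K (trunc_hankel M h \<phi>) f = k"
  proof (rule adjoint_on_eqI[OF K k(1)])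
    fix a assume a: "a \<in> K"
    then have "?V a \<in> M"
      using VK by blast
    then have *: "cinner (?V a) (proj (ortho M) g) = 0"
      by (intro ortho_cinner_eq_0[of _ M] proj_ortho M)
    have "cinner (trunc_hankel M h \<phi> a) f = cinner (mult_op \<phi> (?V a)) f"
      by (simp add: trunc_hankel_def cinner_proj_ortho M f)
    also have "\<dots> = cinner (?V a) g"
      unfolding g_def by (rule cinner_mult_op[OF \<phi>])
    also have "\<dots> = cinner (?V a) (?V k)"
      by (simp add: k(2) cinner_diff_right *)
    also have "\<dots> = cinner a k"
      by (rule isometric_mult_onto_cinner[OF K iso a k(1)])
    finally show "cinner (trunc_hankel M h \<phi> a) f = cinner a k" .
  qed
  then show ?thesis
    by (simp add: trunc_hankel_def k(2))
qed

text \<open>The common form of both identities. With \<open>P\<close> the projection onto the orthogonal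
  complement of \<open>M\<close>, the left side is \<open>P M\<^sub>\<phi> P M\<^sub>\<psi> f\<close> for \<open>\<psi>\<close> the conjugate of \<open>\<phi>\<close>, and
  \<open>P = 1 - (1 - P)\<close> in the middle splits it into \<open>P M\<^sub>\<phi> M\<^sub>\<psi> f\<close> and the Hankel term.\<close>

lemma dual_toeplitz_product:
  assumes M: "csubspace M" "closed M" and K: "csubspace K"
    and iso: "isometric_mult_onto h K M" and \<phi>: "\<phi> \<in> Linfty" and f: "f \<in> ortho M"
  shows "dual_toeplitz M \<phi> (dual_toeplitz M (\<lambda>z. cnj (\<phi> z)) f)
    = dual_toeplitz M (\<lambda>z. complex_of_real ((cmod (\<phi> z))\<^sup>2)) f
      - trunc_hankel M h \<phi> (adjoint_on K (trunc_hankel M h \<phi>) f)"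
proof -
  let ?P = "proj (ortho M)"
  define g where "g = mult_op (\<lambda>z. cnj (\<phi> z)) f"
  have "mult_op (\<lambda>z. complex_of_real ((cmod (\<phi> z))\<^sup>2)) f = mult_op \<phi> g"
    unfolding g_def by (simp only: mult_op_mult_op[OF \<phi> Linfty_cnj[OF \<phi>]] complex_norm_square)
  moreover have "?P (mult_op \<phi> (g - ?P g)) = ?P (mult_op \<phi> g) - ?P (mult_op \<phi> (?P g))"
    by (simp add: mult_op_diff[OF \<phi>] proj_ortho_diff[OF M])
  ultimately show ?thesis
    unfolding trunc_hankel_adjoint[OF assms] dual_toeplitz_def by (simp flip: g_def)
qed

theorem theorem4p3:
  fixes M :: "circle_L2 set" and u h :: circle_L2 and \<phi> :: "complex \<Rightarrow> complex"
  assumes "nearly_invariant M" and "M \<noteq> {0}" and "M \<noteq> Hardy2"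
    and "inner_function u" and "\<nexists>c. u = const_L2 c" and "hardy_eval u 0 = 0"
    and "extremal_function M h"
    and "isometric_mult_onto h (model_space u) M"
    and "\<phi> \<in> Linfty"
  shows "(\<forall>f\<in>ortho M.
           dual_toeplitz M \<phi> (adjoint_on (ortho M) (dual_toeplitz M \<phi>) f) =
           dual_toeplitz M (\<lambda>z. complex_of_real ((cmod (\<phi> z))\<^sup>2)) f -
           trunc_hankel M h \<phi> (adjoint_on (model_space u) (trunc_hankel M h \<phi>) f)) \<and>
         (\<forall>f\<in>ortho M.
           adjoint_on (ortho M) (dual_toeplitz M \<phi>) (dual_toeplitz M \<phi> f) =
           dual_toeplitz M (\<lambda>z. complex_of_real ((cmod (\<phi> z))\<^sup>2)) f -
           trunc_hankel M h (\<lambda>z. cnj (\<phi> z))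
             (adjoint_on (model_space u) (trunc_hankel M h (\<lambda>z. cnj (\<phi> z))) f))"
proof -
  have M: "csubspace M" "closed M"
    using assms(1) by (auto simp: nearly_invariant_def)
  note K = csubspace_model_space[of u] and iso = assms(8) and \<phi> = assms(9)
  have "dual_toeplitz M \<phi> f \<in> ortho M" for f
    by (simp add: dual_toeplitz_def proj_ortho M)
  then show ?thesis
    using dual_toeplitz_product[OF M K iso \<phi>] dual_toeplitz_product[OF M K iso Linfty_cnj[OF \<phi>]]
    by (simp add: adjoint_dual_toeplitz M \<phi>)
qed

end
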